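(* Let $X,Y$ be nonempty words over $\{L,M,R\}$ with $XY=\overline{Y}X$. Then the words $XY\,\overline{XY}$ and $\overline{Y}XY\overline{X}$ are not primitive.
   Context: Words are finite sequences over the alphabet $\{L,M,R\}$. The complement $\overline{w}$ of a word $w$ is obtained letterwise from $\overline{R}=L$, $\overline{L}=R$, $\overline{M}=M$. A word $w$ is primitive if $w\neq u^{l}$ for every word $u$ and every integer $l\ge2$. *)

theory Defs
  imports Main
begin

datatype letter = L | M | R

type_synonym word = "letter list"

fun complement_letter :: "letter \<Rightarrow> letter" where
  "complement_letter R = L"
| "complement_letter L = R"
| "complement_letter M = M"

(* Letterwise: the order of the letters is not reversed. *)
definition complement :: "word \<Rightarrow> word" where
  "complement w = map complement_letter w"

definition word_power :: "word \<Rightarrow> nat \<Rightarrow> word" where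
  "word_power u l = concat (replicate l u)"

(* The base u ranges over all words, so the empty word is not primitive. *)
definition primitive :: "word \<Rightarrow> bool" where
  "primitive w \<longleftrightarrow> (\<forall>u. \<forall>l\<ge>2. w \<noteq> word_power u l)"

end

theory Submission
  imports Defs
begin

text \<open>
  Write \<open>X'\<close> for the complement of \<open>X\<close>. From \<open>XY = Y'X\<close> one gets \<open>X'Y' = YX'\<close>, so both
  words of the theorem equal \<open>XYYX'\<close>, and \<open>X'XY = X'Y'X = YX'X\<close>. Hence \<open>X'X\<close> and \<open>Y\<close> commute and
  are powers of a common word \<open>z\<close>. So \<open>X'XYY\<close> is a power of \<open>z\<close> with exponent at least 2, and
  \<open>XYYX'\<close>, being conjugate to it, is a power with the same exponent.
\<close>

lemma complement_append: "complement (u @ v) = complement u @ complement v"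
  by (simp add: complement_def)

lemma complement_complement [simp]: "complement (complement w) = w"
proof -
  have "complement_letter (complement_letter a) = a" for a
    by (cases a) simp_all
  then show ?thesis by (simp add: complement_def comp_def)
qed

lemma word_power_add: "word_power u (k + l) = word_power u k @ word_power u l"
  by (simp add: word_power_def replicate_add)

text \<open>Both sides spell \<open>a w a w ... a\<close>; only the grouping into blocks differs.
  This regrouping shows that \<open>rotate1\<close> turns a power into a power of the rotated
  base.\<close>

lemma word_power_Cons_shift: "a # word_power (w @ [a]) k = word_power (a # w) k @ [a]"
  by (induction k) (simp_all add: word_power_def)

lemma rotate1_word_power: "rotate1 (word_power z k) = word_power (rotate1 z) k"
proof (cases z)
  case Nil
  then show ?thesis by (simp add: word_power_def)
next
  case (Cons a w)
  show ?thesis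
  proof (cases k)
    case 0
    then show ?thesis by (simp add: word_power_def)
  next
    case (Suc l)
    have "word_power (a # w) (Suc l) = a # w @ word_power (a # w) l"
      and "word_power (w @ [a]) (Suc l) = w @ a # word_power (w @ [a]) l"
      by (simp_all add: word_power_def)
    then show ?thesis using Cons Suc word_power_Cons_shift by simp
  qed
qed

lemma rotate_word_power: "rotate n (word_power z k) = word_power (rotate n z) k"
  by (induction n) (simp_all add: rotate1_word_power)

text \<open>\<open>v @ u\<close> is \<open>u @ v\<close> rotated by \<open>length u\<close>, and
  rotating a power rotates its base, so \<open>rotate (length u) z\<close> serves as
  \<open>y\<close>.\<close>

lemma word_power_conjugate:
  assumes "u @ v = word_power z k"
  shows "\<exists>y. v @ u = word_power y k"
  by (metis assms rotate_append rotate_word_power)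

theorem proposition3p4:
  fixes X Y :: word
  assumes "X \<noteq> []" and "Y \<noteq> []"
    and "X @ Y = complement Y @ X"
  shows "\<not> primitive (X @ Y @ complement (X @ Y)) \<and>
         \<not> primitive (complement Y @ X @ Y @ complement X)"
proof -
  let ?X' = "complement X" and ?Y' = "complement Y"
  have compl: "?X' @ ?Y' = Y @ ?X'"
    using assms(3) by (metis complement_append complement_complement)
  then have "(?X' @ X) @ Y = Y @ (?X' @ X)"
    using assms(3) by (metis append.assoc)
  then obtain m n z where m: "?X' @ X = word_power z m" and n: "Y = word_power z n"
    unfolding word_power_def by (metis comm_append_are_replicate)
  \<comment> \<open>\<open>Y\<close> is used twice, so a positive \<open>n\<close> alone brings the
    exponent to at least 2.\<close>
  have "n \<noteq> 0"
    using n assms(2) by (auto simp: word_power_def)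
  then have "m + (n + n) \<ge> 2"
    by simp
  have "?X' @ (X @ Y @ Y) = word_power z (m + (n + n))"
    using m n by (metis append.assoc word_power_add)
  from word_power_conjugate[OF this] obtain y
    where "X @ Y @ Y @ ?X' = word_power y (m + (n + n))"
    by auto
  with \<open>m + (n + n) \<ge> 2\<close> have "\<not> primitive (X @ Y @ Y @ ?X')"
    unfolding primitive_def by metis
  moreover have "X @ Y @ complement (X @ Y) = X @ Y @ Y @ ?X'"
    by (simp add: complement_append compl)
  moreover have "?Y' @ X @ Y @ ?X' = X @ Y @ Y @ ?X'"
    using assms(3) by (metis append.assoc)
  ultimately show ?thesis by metis
qed

end
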